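(* Let $S_1,S_2\subseteq\mathbb{F}_2^n$ be powerful sets. Define $S_1\diamond S_2\subseteq\mathbb{F}_2^{n+3}$ as follows: let $A:=\{\mathbf{v}0\mid\mathbf{v}\in S_1\}\subseteq\mathbb{F}_2^{n+1}$ and $B:=\{\mathbf{0}_n0\}\cup\{\mathbf{v}1\mid \mathbf{v}\in S_2\setminus\{\mathbf{0}_n\}\}\subseteq\mathbb{F}_2^{n+1}$, and \[S_1\diamond S_2:=\{\mathbf{w}00\mid \mathbf{w}\in A\cap B\}\cup\{\mathbf{w}01\mid \mathbf{w}\in A\setminus B\}\cup\{\mathbf{w}10\mid \mathbf{w}\in B\setminus A\}\cup\{\mathbf{w}11\mid \mathbf{w}\in\mathbb{F}_2^{n+1}\setminus(A\cup B)\}.\] Then $S_1\diamond S_2$ is a powerful set.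
   Context: Juxtaposition denotes appending bits to a vector; $\mathbf{0}_n$ is the zero vector of length $n$. A set $S\subseteq\mathbb{F}_2^n$ (positions indexed by $[n]$) is a powerful set if for every $X\subseteq[n]$ the number of vectors in $S$ that are zero in all positions of $X$ is a power of $2$. *)

theory Defs
  imports Main "HOL-Library.Z2"
begin

text \<open>A vector of \<open>\<bbbF>\<^sub>2\<^sup>n\<close> is a list of \<open>n\<close> bits over the two-element field \<^typ>\<open>bit\<close>;
  juxtaposition is list append.\<close>

definition F2_vecs :: "nat \<Rightarrow> bit list set" where
  "F2_vecs n = {v. length v = n}"

abbreviation zero_vec :: "nat \<Rightarrow> bit list" where
  "zero_vec n \<equiv> replicate n 0"

text \<open>Position \<open>i \<in> [n] = {1,\<dots>,n}\<close> is represented by the list index \<open>i - 1\<close>.\<close>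

definition powerful_set :: "nat \<Rightarrow> bit list set \<Rightarrow> bool" where
  "powerful_set n S \<longleftrightarrow>
     S \<subseteq> F2_vecs n \<and>
     (\<forall>X. X \<subseteq> {..<n} \<longrightarrow> (\<exists>k::nat. card {v \<in> S. \<forall>i\<in>X. v ! i = 0} = 2 ^ k))"

definition diamond_A :: "bit list set \<Rightarrow> bit list set" where
  "diamond_A S1 = {v @ [0] | v. v \<in> S1}"

definition diamond_B :: "nat \<Rightarrow> bit list set \<Rightarrow> bit list set" where
  "diamond_B n S2 = {zero_vec n @ [0]} \<union> {v @ [1] | v. v \<in> S2 - {zero_vec n}}"

definition diamond :: "nat \<Rightarrow> bit list set \<Rightarrow> bit list set \<Rightarrow> bit list set" where
  "diamond n S1 S2 =
     (let A = diamond_A S1; B = diamond_B n S2 in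
        {w @ [0, 0] | w. w \<in> A \<inter> B} \<union>
        {w @ [0, 1] | w. w \<in> A - B} \<union>
        {w @ [1, 0] | w. w \<in> B - A} \<union>
        {w @ [1, 1] | w. w \<in> F2_vecs (n + 1) - (A \<union> B)})"

end

theory Submission
  imports Defs
begin

text \<open>
  The last two bits of an element of \<open>S\<^sub>1 \<diamond> S\<^sub>2\<close> are the indicators of \<open>w \<notin> A\<close> and \<open>w \<notin> B\<close>, so
  \<open>S\<^sub>1 \<diamond> S\<^sub>2\<close> is the graph of a function on \<open>\<bbbF>\<^sub>2\<^bsup>n+1\<^esup>\<close>, and prescribing zeros in it amounts to counting
  the \<open>w\<close> with prescribed zeros in all of \<open>\<bbbF>\<^sub>2\<^bsup>n+1\<^esup>\<close>, in \<open>A\<close>, in \<open>B\<close> or in \<open>A \<inter> B\<close>. Each of these sets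
  is powerful. Since a powerful set contains the zero vector, \<open>A \<inter> B\<close> is the zero vector alone; the
  extra bit of \<open>B\<close> vanishes only at the zero vector, and deleting it is a bijection onto \<open>S\<^sub>2\<close>.
\<close>

definition zeros_on :: "nat set \<Rightarrow> bit list set \<Rightarrow> bit list set" where
  "zeros_on X S = {v \<in> S. \<forall>i\<in>X. v ! i = 0}"

lemma powerful_set_iff_zeros_on:
  "powerful_set n S \<longleftrightarrow>
     S \<subseteq> F2_vecs n \<and> (\<forall>X\<subseteq>{..<n}. \<exists>k::nat. card (zeros_on X S) = 2 ^ k)"
  by (simp add: powerful_set_def zeros_on_def)

lemma powerful_setD:
  assumes "powerful_set n S"
  shows "S \<subseteq> F2_vecs n" "X \<subseteq> {..<n} \<Longrightarrow> \<exists>k::nat. card (zeros_on X S) = 2 ^ k"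
  using assms by (auto simp: powerful_set_iff_zeros_on)

lemma zeros_on_lessThan:
  assumes "S \<subseteq> F2_vecs n"
  shows "zeros_on {..<n} S = S \<inter> {zero_vec n}"
  using assms by (auto simp: zeros_on_def F2_vecs_def list_eq_iff_nth_eq)

text \<open>Requiring zeros in all positions leaves at most the zero vector, so without it the count
  would be 0, which is not a power of 2.\<close>

lemma zero_vec_in_powerful_set:
  assumes "powerful_set n S"
  shows "zero_vec n \<in> S"
proof (rule ccontr)
  assume "zero_vec n \<notin> S"
  then have "card (zeros_on {..<n} S) = 0"
    using zeros_on_lessThan[OF powerful_setD(1)[OF assms]] by simp
  then show False
    using powerful_setD(2)[OF assms, of "{..<n}"] by simp
qed

text \<open>A bit vector is determined by its support, and vanishing on \<open>X\<close> means that
  the support avoids \<open>X\<close>. The count is thus the number of subsets of the complement of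
  \<open>X\<close>.\<close>

lemma powerful_set_F2_vecs: "powerful_set n (F2_vecs n)"
proof -
  have "card (zeros_on X (F2_vecs n)) = 2 ^ card ({..<n} - X)" if "X \<subseteq> {..<n}" for X
  proof -
    let ?supp = "\<lambda>v :: bit list. {i. i < n \<and> v ! i \<noteq> 0}"
    have "inj_on ?supp (zeros_on X (F2_vecs n))"
    proof (rule inj_onI)
      fix v w
      assume "v \<in> zeros_on X (F2_vecs n)" "w \<in> zeros_on X (F2_vecs n)" and eq: "?supp v = ?supp w"
      then have len: "length v = n" "length w = n"
        by (auto simp: zeros_on_def F2_vecs_def)
      have "v ! i = w ! i" if "i < n" for i
      proof -
        have "v ! i \<noteq> 0 \<longleftrightarrow> w ! i \<noteq> 0"
          using eq that by blast
        then show ?thesis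
          by (cases "v ! i"; cases "w ! i") simp_all
      qed
      then show "v = w"
        using len by (simp add: list_eq_iff_nth_eq)
    qed
    moreover have "?supp ` zeros_on X (F2_vecs n) = Pow ({..<n} - X)"
    proof (intro equalityI subsetI)
      fix Y assume Y: "Y \<in> Pow ({..<n} - X)"
      \<comment> \<open>The indicator vector of \<open>Y\<close> is the preimage of \<open>Y\<close>
        under \<open>?supp\<close>.\<close>
      define v :: "bit list" where "v = map (\<lambda>i. of_bool (i \<in> Y)) [0..<n]"
      have nth: "v ! i = of_bool (i \<in> Y)" if "i < n" for i
        using that by (simp add: v_def)
      have "v ! i = 0" if "i \<in> X" for i
      proof -
        have "i < n" "i \<notin> Y"
          using that \<open>X \<subseteq> {..<n}\<close> Y by auto
        then show ?thesis
          by (simp add: nth)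
      qed
      then have "v \<in> zeros_on X (F2_vecs n)"
        by (simp add: zeros_on_def F2_vecs_def v_def)
      moreover have "Y = ?supp v"
        using Y by (auto simp: nth)
      ultimately show "Y \<in> ?supp ` zeros_on X (F2_vecs n)"
        by (rule rev_image_eqI)
    qed (auto simp: zeros_on_def)
    ultimately have "card (zeros_on X (F2_vecs n)) = card (Pow ({..<n} - X))"
      using card_image by fastforce
    then show ?thesis
      by (simp add: card_Pow)
  qed
  then show ?thesis
    by (auto simp: powerful_set_iff_zeros_on)
qed

text \<open>The appended bit at index \<open>n\<close> is always 0, so \<open>n \<in> X\<close>
  imposes no condition and \<open>X\<close> can be cut down to the first \<open>n\<close>
  positions.\<close>

lemma powerful_set_diamond_A:
  assumes "powerful_set n S"
  shows "powerful_set (n + 1) (diamond_A S)"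
proof -
  have len: "length v = n" if "v \<in> S" for v
    using powerful_setD(1)[OF assms] that by (auto simp: F2_vecs_def)
  have "\<exists>k::nat. card (zeros_on X (diamond_A S)) = 2 ^ k" if X: "X \<subseteq> {..<n + 1}" for X
  proof -
    have zero_iff: "(\<forall>i\<in>X. (v @ [0]) ! i = 0) \<longleftrightarrow> (\<forall>i\<in>X \<inter> {..<n}. v ! i = 0)"
      if "v \<in> S" for v
      using X len[OF that] by (fastforce simp: nth_append less_Suc_eq)
    have "zeros_on X (diamond_A S) = (\<lambda>v. v @ [0]) ` zeros_on (X \<inter> {..<n}) S"
      using zero_iff by (auto simp: zeros_on_def diamond_A_def)
    then have "card (zeros_on X (diamond_A S)) = card (zeros_on (X \<inter> {..<n}) S)"
      by (simp add: card_image inj_on_def)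
    then show ?thesis
      using powerful_setD(2)[OF assms, of "X \<inter> {..<n}"] by simp
  qed
  then show ?thesis
    by (auto simp: powerful_set_iff_zeros_on diamond_A_def F2_vecs_def len)
qed

lemma powerful_set_diamond_B:
  assumes "powerful_set n S"
  shows "powerful_set (n + 1) (diamond_B n S)"
proof -
  have len: "length v = n" if "v \<in> S" for v
    using powerful_setD(1)[OF assms] that by (auto simp: F2_vecs_def)
  \<comment> \<open>Because the zero vector lies in \<open>S\<close>, the separately listed element
    of \<open>diamond_B n S\<close> is its image, and the whole set becomes one injective image of
    \<open>S\<close>.\<close>
  let ?g = "\<lambda>v. v @ [of_bool (v \<noteq> zero_vec n)] :: bit list"
  have B: "diamond_B n S = ?g ` S"
    using zero_vec_in_powerful_set[OF assms] by (auto simp: diamond_B_def image_iff)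
  have "\<exists>k::nat. card (zeros_on X (?g ` S)) = 2 ^ k" if X: "X \<subseteq> {..<n + 1}" for X
  proof (cases "n \<in> X")
    case True
    \<comment> \<open>Index \<open>n\<close> is the appended bit, so only the image of the zero
      vector survives.\<close>
    then have "zeros_on X (?g ` S) = {?g (zero_vec n)}"
      using X zero_vec_in_powerful_set[OF assms] len
      by (fastforce simp: zeros_on_def nth_append less_Suc_eq)
    then have "card (zeros_on X (?g ` S)) = 2 ^ 0"
      by simp
    then show ?thesis
      by (rule exI)
  next
    case False
    then have X': "X \<subseteq> {..<n}"
      using X less_Suc_eq by fastforce
    then have zero_iff: "(\<forall>i\<in>X. ?g v ! i = 0) \<longleftrightarrow> (\<forall>i\<in>X. v ! i = 0)" if "v \<in> S" for v
      using len[OF that] by (fastforce simp: nth_append)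
    have "zeros_on X (?g ` S) = ?g ` zeros_on X S"
      using zero_iff by (auto simp: zeros_on_def)
    then have "card (zeros_on X (?g ` S)) = card (zeros_on X S)"
      by (simp add: card_image inj_on_def)
    then show ?thesis
      using powerful_setD(2)[OF assms X'] by simp
  qed
  then show ?thesis
    unfolding B by (auto simp: powerful_set_iff_zeros_on F2_vecs_def len)
qed

lemma diamond_A_Int_diamond_B:
  assumes "powerful_set n S1"
  shows "diamond_A S1 \<inter> diamond_B n S2 = {zero_vec (n + 1)}"
proof -
  have "diamond_A S1 \<inter> diamond_B n S2 = {zero_vec n @ [0]}"
    using zero_vec_in_powerful_set[OF assms] by (auto simp: diamond_A_def diamond_B_def)
  then show ?thesis
    by (simp add: replicate_append_same)
qed

lemma powerful_set_zero_vec: "powerful_set n {zero_vec n}"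
proof -
  have "zeros_on X {zero_vec n} = {zero_vec n}" if "X \<subseteq> {..<n}" for X
    using that by (auto simp: zeros_on_def)
  then show ?thesis
    by (auto simp: powerful_set_iff_zeros_on F2_vecs_def intro: exI[of _ 0])
qed

text \<open>The four pieces are the four cases of membership in the two sets. The inclusions ensure
  that the first three pieces also range over vectors of length \<open>n + 1\<close> only.\<close>

lemma diamond_eq_image:
  assumes "diamond_A S1 \<subseteq> F2_vecs (n + 1)" "diamond_B n S2 \<subseteq> F2_vecs (n + 1)"
  shows "diamond n S1 S2 =
    (\<lambda>w. w @ [of_bool (w \<notin> diamond_A S1), of_bool (w \<notin> diamond_B n S2)]) ` F2_vecs (n + 1)"
  using assms unfolding diamond_def Let_def by (auto simp: image_iff)

theorem theorem13:
  fixes n :: nat and S1 S2 :: "bit list set"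
  assumes "powerful_set n S1" and "powerful_set n S2"
  shows "powerful_set (n + 3) (diamond n S1 S2)"
proof -
  define A B F where "A = diamond_A S1" and "B = diamond_B n S2" and "F = F2_vecs (n + 1)"
  have pow: "powerful_set (n + 1) A" "powerful_set (n + 1) B"
    "powerful_set (n + 1) (A \<inter> B)" "powerful_set (n + 1) F"
    using powerful_set_diamond_A[OF assms(1)] powerful_set_diamond_B[OF assms(2)]
      diamond_A_Int_diamond_B[OF assms(1), of S2] powerful_set_zero_vec[of "n + 1"]
      powerful_set_F2_vecs[of "n + 1"]
    by (simp_all only: A_def B_def F_def)
  have sub: "A \<subseteq> F" "B \<subseteq> F"
    using pow(1,2)[THEN powerful_setD(1)] by (simp_all add: F_def)
  define f where "f w = w @ [of_bool (w \<notin> A), of_bool (w \<notin> B)]" for w :: "bit list"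
  have D: "diamond n S1 S2 = f ` F"
    using diamond_eq_image sub unfolding A_def B_def F_def f_def by simp
  have len: "length w = n + 1" if "w \<in> F" for w
    using that by (simp add: F_def F2_vecs_def)
  have "\<exists>k::nat. card (zeros_on X (f ` F)) = 2 ^ k" if X: "X \<subseteq> {..<n + 3}" for X
  proof -
    \<comment> \<open>A zero at index \<open>n + 1\<close> of \<open>f w\<close> says
      \<open>w \<in> A\<close>, and one at index \<open>n + 2\<close> says \<open>w \<in> B\<close>.
      The default \<open>F\<close> stands for no condition.\<close>
    define T where "T = (if n + 1 \<in> X then A else F) \<inter> (if n + 2 \<in> X then B else F)"
    have "T \<in> {A, B, A \<inter> B, F}"
      using sub by (auto simp: T_def)
    then have T: "powerful_set (n + 1) T"
      using pow by blast
    have zero_iff: "(\<forall>i\<in>X. f w ! i = 0) \<longleftrightarrow> w \<in> T \<and> (\<forall>i\<in>X \<inter> {..<n + 1}. w ! i = 0)"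
      if w: "w \<in> F" for w
    proof -
      have split: "X = (X \<inter> {..<n + 1}) \<union> (X \<inter> {n + 1}) \<union> (X \<inter> {n + 2})"
        using X by fastforce
      have "(\<forall>i\<in>X. f w ! i = 0) \<longleftrightarrow> (\<forall>i\<in>X \<inter> {..<n + 1}. f w ! i = 0) \<and>
          (n + 1 \<in> X \<longrightarrow> f w ! (n + 1) = 0) \<and> (n + 2 \<in> X \<longrightarrow> f w ! (n + 2) = 0)"
        by (subst split) blast
      moreover have "f w ! i = w ! i" if "i < n + 1" for i
        using that len[OF w] by (simp add: f_def nth_append)
      moreover have "f w ! (n + 1) = of_bool (w \<notin> A)" "f w ! (n + 2) = of_bool (w \<notin> B)"
        using len[OF w] by (simp_all add: f_def nth_append)
      ultimately show ?thesis
        using w by (auto simp: T_def)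
    qed
    have "T \<subseteq> F"
      using powerful_setD(1)[OF T] by (simp add: F_def)
    then have "zeros_on X (f ` F) = f ` zeros_on (X \<inter> {..<n + 1}) T"
      using zero_iff by (auto simp: zeros_on_def)
    \<comment> \<open>The suffix always has length two, so \<open>w\<close> can be read off from
      \<open>f w\<close>, and counting in the image reduces to counting in \<open>T\<close>.\<close>
    moreover have "inj f"
      by (auto simp: f_def inj_def)
    ultimately have "card (zeros_on X (f ` F)) = card (zeros_on (X \<inter> {..<n + 1}) T)"
      by (simp add: card_image inj_on_subset)
    then show ?thesis
      using powerful_setD(2)[OF T, of "X \<inter> {..<n + 1}"] by simp
  qed
  moreover have "f ` F \<subseteq> F2_vecs (n + 3)"
    using len by (auto simp: f_def F2_vecs_def)
  ultimately show ?thesis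
    unfolding D powerful_set_iff_zeros_on by blast
qed

end
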